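(* Let $G=(V,E)$ be a finite undirected graph with $|V|$ odd and with edge expansion $c>2$. Then the Tseitin polytope $P_{TS(G)}$ has split rank at least $\frac{c-2}{2}|V|$. If, moreover, $G$ is $d$-regular, then the split rank of $P_{TS(G)}$ is at least $\frac{c-2}{d}|E|$.
   Context: Edge expansion: for disjoint $V_1,V_2\subseteq V$ let $e_G(V_1,V_2)$ be the number of edges of $G$ with one endpoint in each of $V_1$ and $V_2$. The edge expansion of $G$ is $\min \frac{e_G(S,V\setminus S)}{|S|}$, the minimum being over all nonempty $S\subseteq V$ with $|S|\le |V|/2$. Tseitin polytope: for $u\in V$ let $N(u)=\{v\in V: uv\in E\}$. The Tseitin polytope $P_{TS(G)}\subseteq[0,1]^{|E|}$ (variables $x_{uv}$ indexed by the edges $uv\in E$) is described by the inequalities $\sum_{v\in N(u)\setminus F} x_{uv}+\sum_{v\in F}(1-x_{uv})\ge 1$ for all $u\in V$ and all $F\subseteq N(u)$ with $|F|$ even, together with $0\le x_{uv}\le 1$ for all $uv\in E$. Split closure and rank: for $P\subseteq\mathbb{R}^n$, the split closure of $P$ is $$SC(P)=\bigcap_{\pi\in\mathbb{Z}^n,\ \pi_0\in\mathbb{Z}}\mathrm{conv}\big(\{x\in P:\pi x\le\pi_0\}\cup\{x\in P:\pi x\ge\pi_0+1\}\big),$$ where $\pi x$ denotes the inner product. Put $SC^0(P)=P$ and $SC^k(P)=SC(SC^{k-1}(P))$ for $k\ge1$. Let $P_I$ denote the convex hull of the integral points of $P$. The split rank of $P$ is the minimum $k\ge0$ such that $SC^k(P)=P_I$.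 *)

theory Defs
  imports "HOL-Analysis.Analysis"
begin

definition simple_graph :: "'v set \<Rightarrow> 'v set set \<Rightarrow> bool" where
  "simple_graph V E \<longleftrightarrow> finite V \<and> (\<forall>e\<in>E. e \<subseteq> V \<and> card e = 2)"

definition neighbours :: "'v set \<Rightarrow> 'v set set \<Rightarrow> 'v \<Rightarrow> 'v set" where
  "neighbours V E u = {v \<in> V. {u, v} \<in> E}"

definition regular_graph :: "'v set \<Rightarrow> 'v set set \<Rightarrow> nat \<Rightarrow> bool" where
  "regular_graph V E d \<longleftrightarrow> (\<forall>u\<in>V. card (neighbours V E u) = d)"

definition edges_between :: "'v set set \<Rightarrow> 'v set \<Rightarrow> 'v set \<Rightarrow> nat" where
  "edges_between E V1 V2 = card {e \<in> E. \<exists>u\<in>V1. \<exists>v\<in>V2. e = {u, v}}"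

(* For finite V the minimum ranges over a nonempty set iff V has at least two elements;
   for smaller V the value is unspecified. *)
definition edge_expansion :: "'v set \<Rightarrow> 'v set set \<Rightarrow> real" where
  "edge_expansion V E =
     Min {real (edges_between E S (V - S)) / real (card S) | S.
            S \<subseteq> V \<and> S \<noteq> {} \<and> real (card S) \<le> real (card V) / 2}"

(* Coordinates are indexed by a finite type 'e through a bijection edge from 'e onto the
   edge set E, so that real ^ 'e is the space of vectors indexed by E, and the variable
   of the edge uv is the coordinate at inv edge {u, v}. *)
definition tseitin_polytope ::
    "'v set \<Rightarrow> 'v set set \<Rightarrow> ('e::finite \<Rightarrow> 'v set) \<Rightarrow> (real ^ 'e) set" where
  "tseitin_polytope V E edge =
     {x. (\<forall>u\<in>V. \<forall>F. F \<subseteq> neighbours V E u \<and> even (card F) \<longrightarrow>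
            (\<Sum>v\<in>neighbours V E u - F. x $ inv edge {u, v})
              + (\<Sum>v\<in>F. 1 - x $ inv edge {u, v}) \<ge> 1)
       \<and> (\<forall>i. 0 \<le> x $ i \<and> x $ i \<le> 1)}"

definition integral_vec :: "real ^ 'n \<Rightarrow> bool" where
  "integral_vec x \<longleftrightarrow> (\<forall>i. x $ i \<in> \<int>)"

definition integer_hull :: "(real ^ 'n) set \<Rightarrow> (real ^ 'n) set" where
  "integer_hull P = convex hull {x \<in> P. integral_vec x}"

definition split_closure :: "(real ^ 'n) set \<Rightarrow> (real ^ 'n) set" where
  "split_closure P =
     (\<Inter>\<pi>\<in>{\<pi>. integral_vec \<pi>}. \<Inter>\<pi>\<^sub>0::int.
        convex hull ({x \<in> P. \<pi> \<bullet> x \<le> of_int \<pi>\<^sub>0} \<union> {x \<in> P. \<pi> \<bullet> x \<ge> of_int \<pi>\<^sub>0 + 1}))"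

(* Infinite if no iterate of the split closure equals the integer hull. *)
definition split_rank :: "(real ^ 'n) set \<Rightarrow> enat" where
  "split_rank P = Inf (enat ` {k. (split_closure ^^ k) P = integer_hull P})"

end

theory Submission imports Defs begin

text \<open>
  Since \<^term>\<open>card V\<close> is odd, no 0/1 labelling of the edges has odd degree sum at every vertex, so the
  integer hull is empty and the split rank is the number of rounds after which the split closure
  becomes empty. The all-\<open>1/2\<close> point has to be kept alive for every \<open>k < (c - 2) n / 2\<close>
  rounds, where \<open>n\<close> is the number of vertices. For regular graphs the bound in terms of edges is the
  same number, by the handshake lemma.

  The points used are half-integral. There is a set \<open>R\<close> of edges that were rounded explicitly, and
  a core \<open>U\<close> of more than half of the vertices. Edges inside \<open>U\<close> and outside \<open>R\<close> have
  value \<open>1/2\<close>, all other edges have value 0 or 1, and the vertices outside \<open>U\<close> have odd degree sum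
  (\<open>partial_rounding\<close>). Such a point lies in the Tseitin polytope as soon as every core vertex has
  two half-valued edges. One round costs one edge: if a split \<open>\<pi>, p\<close> cuts off a half-integral point,
  then some half-valued coordinate has an odd coefficient in \<open>\<pi>\<close>, and rounding it to 0 and to 1
  gives two points that satisfy the split and have the original point as midpoint
  (\<open>split_closure_half_integral\<close>).

  This step needs a core that is 3-edge-connected after the removal of \<open>R\<close>, so that it remains
  2-edge-connected when one more edge is lost. The core is therefore shrunk to a minimal large
  one whose boundary has at most two edges outside \<open>R\<close> per discarded vertex. Were it not
  3-edge-connected, then a side of a cut with at most two edges could be discarded, unless the discarded
  set and the two sides all have at most \<open>n / 2\<close> vertices. Then expansion applies to all three: at
  least \<open>c n / 2\<close> edges run between them, and all but \<open>2 |V - U| + 2 \<le> n + 1\<close> of these are in \<open>R\<close>,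
  which is too many for \<open>R\<close> (\<open>obtain_3_edge_connected_core\<close>). The allowance of two edges per
  discarded vertex is what turns \<open>c\<close> into \<open>c - 2\<close>.

  Shrinking the core costs no round: the point with the old core is the average, over all ways of
  labelling the newly discarded edges that make the discarded vertices odd, of points with the new core
  (\<open>partial_rounding_average\<close>), and split closures are convex.
\<close>

section \<open>Edge cuts and prescribed degree parities\<close>

definition incident :: "('e \<Rightarrow> 'v set) \<Rightarrow> 'e set \<Rightarrow> 'v \<Rightarrow> 'e set" where
  "incident edge D v = {i \<in> D. v \<in> edge i}"

definition cut_edges :: "('e \<Rightarrow> 'v set) \<Rightarrow> 'e set \<Rightarrow> 'v set \<Rightarrow> 'e set" where
  "cut_edges edge F T = {i \<in> F. \<exists>u\<in>edge i. \<exists>v\<in>edge i. u \<in> T \<and> v \<notin> T}"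

definition edge_connected :: "nat \<Rightarrow> ('e \<Rightarrow> 'v set) \<Rightarrow> 'e set \<Rightarrow> 'v set \<Rightarrow> bool" where
  "edge_connected m edge F U \<longleftrightarrow> (\<forall>T. T \<noteq> {} \<and> T \<subset> U \<longrightarrow> m \<le> card (cut_edges edge F T))"

lemma card_eq_card_Diff_plus:
  assumes "finite B" "A \<subseteq> B"
  shows "card B = card (B - A) + card A"
proof -
  have "card (B - A) = card B - card A" using assms card_Diff_subset finite_subset by blast
  moreover have "card A \<le> card B" using assms by (rule card_mono)
  ultimately show ?thesis by simp
qed

lemma odd_card_sym_diff:
  assumes "finite A" "finite B"
  shows "odd (card (sym_diff A B)) \<longleftrightarrow> odd (card A) \<noteq> odd (card B)"
proof -
  have "card A = card (A - B) + card (A \<inter> B)"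
    by (metis assms(1) card_Int_Diff add.commute)
  moreover have "card B = card (B - A) + card (A \<inter> B)"
    by (metis assms(2) card_Int_Diff add.commute Int_commute)
  moreover have "card (sym_diff A B) = card (A - B) + card (B - A)"
    using assms by (intro card_Un_disjoint) auto
  ultimately show ?thesis by auto
qed

lemma odd_incident_sym_diff:
  assumes "finite D" "finite C"
  shows "odd (card (incident edge (sym_diff D C) v)) \<longleftrightarrow>
    odd (card (incident edge D v)) \<noteq> odd (card (incident edge C v))"
proof -
  have "incident edge (sym_diff D C) v = sym_diff (incident edge D v) (incident edge C v)"
    by (auto simp: incident_def)
  then show ?thesis
    using assms by (simp add: odd_card_sym_diff incident_def)
qed

text \<open>
  This is the existence of T-joins when there is a way out of \<open>W\<close>: an edge that leaves \<open>W\<close> has exactly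
  one endpoint \<open>u\<close> in \<open>W\<close>, so after the parities on \<open>W - {u}\<close> have been arranged by induction,
  toggling this edge corrects the parity at \<open>u\<close> alone.
\<close>

lemma prescribed_parities:
  assumes "finite W" and "finite F" and "\<forall>i\<in>F. card (edge i) = 2"
    and "\<And>T. T \<subseteq> W \<Longrightarrow> T \<noteq> {} \<Longrightarrow> cut_edges edge F T \<noteq> {}"
  shows "\<exists>D\<subseteq>F. \<forall>w\<in>W. odd (card (incident edge D w)) \<longleftrightarrow> w \<in> b"
  using assms(1,4)
proof (induction W rule: finite_psubset_induct)
  case (psubset W)
  show ?case
  proof (cases "W = {}")
    case True
    then show ?thesis by auto
  next
    case False
    then obtain f u v where f: "f \<in> F" "u \<in> edge f" "v \<in> edge f" "u \<in> W" "v \<notin> W"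
      using psubset.prems[of W] by (auto simp: cut_edges_def)
    have "u \<noteq> v"
      using f by auto
    then have "card {u, v} = 2"
      by simp
    then have ef: "edge f = {u, v}"
      using assms(3) f card_subset_eq[of "edge f" "{u, v}"] card.infinite[of "edge f"] by fastforce
    obtain D where D: "D \<subseteq> F" "\<forall>w\<in>W-{u}. odd (card (incident edge D w)) \<longleftrightarrow> w \<in> b"
    proof -
      have "W - {u} \<subset> W" using f by blast
      moreover have "cut_edges edge F T \<noteq> {}" if "T \<subseteq> W - {u}" "T \<noteq> {}" for T
        using psubset.prems that by blast
      ultimately show thesis using psubset.IH that by metis
    qed
    have finD: "finite D" using D(1) assms(2) finite_subset by auto
    show ?thesis
    proof (cases "odd (card (incident edge D u)) \<longleftrightarrow> u \<in> b")
      case True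
      then show ?thesis using D by blast
    next
      case bad: False
      have inc: "incident edge {f} w = (if w = u then {f} else {})" if "w \<in> W" for w
        using that f ef by (auto simp: incident_def)
      have "\<forall>w\<in>W. odd (card (incident edge (sym_diff D {f}) w)) \<longleftrightarrow> w \<in> b"
      proof
        fix w assume w: "w \<in> W"
        show "odd (card (incident edge (sym_diff D {f}) w)) \<longleftrightarrow> w \<in> b"
          unfolding odd_incident_sym_diff[OF finD finite.insertI[OF finite.emptyI]] inc[OF w]
          using bad D(2) w by auto
      qed
      moreover have "sym_diff D {f} \<subseteq> F" using D(1) f(1) by auto
      ultimately show ?thesis by blast
    qed
  qed
qed

section \<open>Half-integral points in the split closure\<close>

text \<open>
  If \<open>x\<close> violates the split, then \<open>\<pi> \<bullet> x\<close> is a half-integer strictly between \<open>p\<close> and \<open>p + 1\<close>,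
  hence \<open>\<pi> $ i\<close> is odd for some half-valued coordinate \<open>i\<close>. Changing this coordinate by \<open>1/2\<close> either
  way makes the product an integer, and no integer violates the split.
\<close>

lemma split_closure_half_integral:
  fixes x :: "real ^ 'e"
  assumes "x \<in> Q" and half: "\<And>i. x $ i \<in> {0, 1/2, 1}"
    and round: "\<And>i t. x $ i = 1/2 \<Longrightarrow> t \<in> {0, 1} \<Longrightarrow> (\<chi> j. if j = i then t else x $ j) \<in> Q"
  shows "x \<in> split_closure Q"
  unfolding split_closure_def
proof (intro INT_I)
  fix \<pi> :: "real ^ 'e" and p :: int
  assume "\<pi> \<in> {\<pi>. integral_vec \<pi>}"
  then have int: "\<And>i. \<pi> $ i \<in> \<int>" by (auto simp: integral_vec_def)
  let ?A = "{x \<in> Q. \<pi> \<bullet> x \<le> of_int p} \<union> {x \<in> Q. \<pi> \<bullet> x \<ge> of_int p + 1}"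
  show "x \<in> convex hull ?A"
  proof (cases "x \<in> ?A")
    case True
    then show ?thesis by (rule hull_inc)
  next
    case False
    then have gap: "of_int p < \<pi> \<bullet> x" "\<pi> \<bullet> x < of_int p + 1"
      using assms(1) by auto
    have "2 * (\<pi> \<bullet> x) = (\<Sum>i\<in>UNIV. \<pi> $ i * (2 * x $ i))"
      by (simp add: inner_vec_def sum_distrib_left mult_ac)
    also have "\<dots> \<in> \<int>"
    proof (rule Ints_sum, rule Ints_mult[OF int])
      fix i show "2 * x $ i \<in> \<int>" using half[of i] by (auto simp: mult.commute)
    qed
    finally obtain m where m: "2 * (\<pi> \<bullet> x) = of_int m" by (auto elim: Ints_cases)
    have "m = 2 * p + 1" using gap m by linarith
    then have px: "\<pi> \<bullet> x = of_int p + 1/2" using m by simp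
    have "\<exists>i q. x $ i = 1/2 \<and> \<pi> $ i = of_int q \<and> odd q"
    proof (rule ccontr)
      assume no: "\<not> ?thesis"
      have "\<pi> $ i * x $ i \<in> \<int>" for i
      proof (cases "x $ i = 1/2")
        case True
        obtain q where q: "\<pi> $ i = of_int q" using int[of i] by (auto elim: Ints_cases)
        then have "even q" using no True by blast
        then obtain q' where "q = 2 * q'" by (auto elim: evenE)
        then have "\<pi> $ i * x $ i = of_int q'" using q True by simp
        then show ?thesis by simp
      next
        case False
        then have "x $ i \<in> \<int>" using half[of i] by auto
        then show ?thesis using int by simp
      qed
      then have "\<pi> \<bullet> x \<in> \<int>" unfolding inner_vec_def by (intro Ints_sum) simp
      then obtain r where "\<pi> \<bullet> x = of_int r" by (auto elim: Ints_cases)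
      then have "of_int p < (of_int r :: real)" "of_int r < (of_int (p + 1) :: real)"
        using gap by simp_all
      then show False unfolding of_int_less_iff by linarith
    qed
    then obtain i q where i: "x $ i = 1/2" and q: "\<pi> $ i = of_int q" "odd q" by blast
    define y where "y t = (\<chi> j. if j = i then t else x $ j)" for t :: real
    have y: "y t = x + (t - 1/2) *\<^sub>R axis i 1" for t
      using i by (auto simp: y_def vec_eq_iff axis_def)
    have "y t \<in> ?A" if t: "t \<in> {0, 1}" for t
    proof -
      obtain q' where q': "q = 2 * q' + 1" using q(2) by (auto elim: oddE)
      have "\<pi> \<bullet> y t = of_int p + 1/2 + (t - 1/2) * of_int q"
        by (simp add: y inner_add_right px inner_axis q(1))
      then have "\<pi> \<bullet> y t = of_int (if t = 0 then p - q' else p + q' + 1)"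
        using t q' by (auto simp: field_simps)
      then obtain r where "\<pi> \<bullet> y t = of_int r" by blast
      moreover have "(of_int r :: real) \<le> of_int p \<or> of_int r \<ge> (of_int p + 1 :: real)"
      proof -
        have "r \<le> p \<or> r \<ge> p + 1" by linarith
        then show ?thesis by (metis of_int_1 of_int_add of_int_le_iff)
      qed
      moreover have "y t \<in> Q" using round[OF i t] by (simp add: y_def)
      ultimately show ?thesis by auto
    qed
    then have "y 0 \<in> convex hull ?A" "y 1 \<in> convex hull ?A"
      by (meson hull_inc insertI1 insertI2)+
    then have "(1/2) *\<^sub>R y 0 + (1/2) *\<^sub>R y 1 \<in> convex hull ?A"
      using convex_convex_hull by (intro convexD) auto
    also have "(1/2) *\<^sub>R y 0 + (1/2) *\<^sub>R y 1 = x"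
      using i by (auto simp: y_def vec_eq_iff)
    finally show ?thesis .
  qed
qed

lemma convex_split_closure: "convex (split_closure P)"
  unfolding split_closure_def by (intro convex_INT convex_convex_hull)

section \<open>The Tseitin polytope in edge coordinates\<close>

locale incidence_graph =
  fixes V :: "'v set" and edge :: "'e::finite \<Rightarrow> 'v set"
  assumes finite_V: "finite V"
    and edge_subset: "edge i \<subseteq> V"
    and card_edge: "card (edge i) = 2"
    and inj_edge: "inj edge"
    and odd_V: "odd (card V)"
begin

abbreviation "induced U \<equiv> {i. edge i \<subseteq> U}"

lemma edge_pair: obtains a b where "edge i = {a, b}" "a \<noteq> b" "a \<in> V" "b \<in> V"
proof -
  obtain a b where "edge i = {a, b}" "a \<noteq> b"
    using card_edge[of i] by (auto simp: card_2_iff)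
  then show thesis using that edge_subset[of i] by auto
qed

lemma bij_neighbours_incident:
  assumes "u \<in> V"
  shows "bij_betw (\<lambda>v. inv edge {u, v}) (neighbours V (range edge) u) (incident edge UNIV u)"
proof (rule bij_betw_imageI)
  have e: "edge (inv edge {u, v}) = {u, v}" if "v \<in> neighbours V (range edge) u" for v
  proof (rule f_inv_into_f)
    show "{u, v} \<in> range edge" using that unfolding neighbours_def by blast
  qed
  show "inj_on (\<lambda>v. inv edge {u, v}) (neighbours V (range edge) u)"
  proof (rule inj_onI)
    fix v w assume "v \<in> neighbours V (range edge) u" "w \<in> neighbours V (range edge) u"
      and "inv edge {u, v} = inv edge {u, w}"
    then have "{u, v} = {u, w}" using e by metis
    then show "v = w" by (auto simp: doubleton_eq_iff)
  qed
  show "(\<lambda>v. inv edge {u, v}) ` neighbours V (range edge) u = incident edge UNIV u"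
  proof
    show "(\<lambda>v. inv edge {u, v}) ` neighbours V (range edge) u \<subseteq> incident edge UNIV u"
      using e by (auto simp: incident_def)
    show "incident edge UNIV u \<subseteq> (\<lambda>v. inv edge {u, v}) ` neighbours V (range edge) u"
    proof
      fix i assume "i \<in> incident edge UNIV u"
      then have "u \<in> edge i" by (simp add: incident_def)
      moreover obtain a b where ab: "edge i = {a, b}" "a \<in> V" "b \<in> V"
        by (rule edge_pair)
      ultimately have "u = a \<or> u = b" by simp
      then obtain v where v: "edge i = {u, v}" "v \<in> V"
        using ab by (metis insert_commute)
      then have "v \<in> neighbours V (range edge) u"
        by (simp add: neighbours_def flip: v(1))
      moreover have "i = inv edge {u, v}"
        by (metis v(1) inj_edge inv_f_f)
      ultimately show "i \<in> (\<lambda>v. inv edge {u, v}) ` neighbours V (range edge) u"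
        by blast
    qed
  qed
qed

text \<open>
  Summing over incident edge indices instead of neighbours turns the left-hand side of each inequality
  into the \<open>L\<^sub>1\<close> distance between \<open>x\<close> and the indicator vector of \<open>I\<close> on the edges at \<open>u\<close>.
\<close>

lemma mem_tseitin_polytope:
  "x \<in> tseitin_polytope V (range edge) edge \<longleftrightarrow>
    (\<forall>u\<in>V. \<forall>I. I \<subseteq> incident edge UNIV u \<and> even (card I) \<longrightarrow>
       (\<Sum>i\<in>incident edge UNIV u. if i \<in> I then 1 - x $ i else x $ i) \<ge> 1)
     \<and> (\<forall>i. 0 \<le> x $ i \<and> x $ i \<le> 1)"
proof -
  have "(\<forall>F. F \<subseteq> neighbours V (range edge) u \<and> even (card F) \<longrightarrow>
            (\<Sum>v\<in>neighbours V (range edge) u - F. x $ inv edge {u, v})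
              + (\<Sum>v\<in>F. 1 - x $ inv edge {u, v}) \<ge> 1) \<longleftrightarrow>
      (\<forall>I. I \<subseteq> incident edge UNIV u \<and> even (card I) \<longrightarrow>
       (\<Sum>i\<in>incident edge UNIV u. if i \<in> I then 1 - x $ i else x $ i) \<ge> 1)" (is "?L \<longleftrightarrow> ?R")
    if u: "u \<in> V" for u
  proof -
    let ?N = "neighbours V (range edge) u" and ?I = "incident edge UNIV u"
    define g where "g v = inv edge {u, v}" for v
    have bij: "bij_betw g ?N ?I"
      using bij_neighbours_incident[OF u] by (simp add: g_def[abs_def])
    then have inj: "inj_on g ?N" and img: "g ` ?N = ?I" by (auto simp: bij_betw_def)
    have finN: "finite ?N" using finite_V by (simp add: neighbours_def)
    have eq: "(\<Sum>v\<in>?N - F. x $ g v) + (\<Sum>v\<in>F. 1 - x $ g v) =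
        (\<Sum>i\<in>?I. if i \<in> g ` F then 1 - x $ i else x $ i)" if F: "F \<subseteq> ?N" for F
    proof -
      have "(\<Sum>i\<in>?I. if i \<in> g ` F then 1 - x $ i else x $ i) =
          (\<Sum>v\<in>?N. if g v \<in> g ` F then 1 - x $ g v else x $ g v)"
        using sum.reindex_bij_betw[OF bij, of "\<lambda>i. if i \<in> g ` F then 1 - x $ i else x $ i"] by simp
      also have "\<dots> = (\<Sum>v\<in>?N. if v \<in> F then 1 - x $ g v else x $ g v)"
        by (rule sum.cong) (use inj F in \<open>auto simp: inj_on_def\<close>)
      also have "\<dots> = (\<Sum>v\<in>?N - F. if v \<in> F then 1 - x $ g v else x $ g v)
          + (\<Sum>v\<in>F. if v \<in> F then 1 - x $ g v else x $ g v)"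
        by (rule sum.subset_diff[OF F finN])
      also have "\<dots> = (\<Sum>v\<in>?N - F. x $ g v) + (\<Sum>v\<in>F. 1 - x $ g v)"
        by (intro arg_cong2[of _ _ _ _ "(+)"] sum.cong) auto
      finally show ?thesis by simp
    qed
    show ?thesis
    proof
      assume L: ?L
      show ?R
      proof (intro allI impI)
        fix I assume I: "I \<subseteq> ?I \<and> even (card I)"
        then obtain F where F: "F \<subseteq> ?N" "I = g ` F" using img by (metis subset_imageE)
        have "card I = card F" using card_image[OF inj_on_subset[OF inj F(1)]] F(2) by simp
        then have "even (card F)" using I by simp
        then have "(\<Sum>v\<in>?N - F. x $ g v) + (\<Sum>v\<in>F. 1 - x $ g v) \<ge> 1"
          using L F(1) unfolding g_def by blast
        then show "(\<Sum>i\<in>?I. if i \<in> I then 1 - x $ i else x $ i) \<ge> 1"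
          using eq[OF F(1)] unfolding F(2) by linarith
      qed
    next
      assume R: ?R
      show ?L
      proof (intro allI impI)
        fix F assume F: "F \<subseteq> ?N \<and> even (card F)"
        have "card (g ` F) = card F" using card_image[OF inj_on_subset[OF inj]] F by blast
        moreover have "g ` F \<subseteq> ?I" using F img by blast
        ultimately have "(\<Sum>i\<in>?I. if i \<in> g ` F then 1 - x $ i else x $ i) \<ge> 1"
          using R F by simp
        then show "(\<Sum>v\<in>?N - F. x $ inv edge {u, v}) + (\<Sum>v\<in>F. 1 - x $ inv edge {u, v}) \<ge> 1"
          using eq[of F] F unfolding g_def by linarith
      qed
    qed
  qed
  then have "(\<forall>u\<in>V. \<forall>F. F \<subseteq> neighbours V (range edge) u \<and> even (card F) \<longrightarrow>
            (\<Sum>v\<in>neighbours V (range edge) u - F. x $ inv edge {u, v})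
              + (\<Sum>v\<in>F. 1 - x $ inv edge {u, v}) \<ge> 1) \<longleftrightarrow>
      (\<forall>u\<in>V. \<forall>I. I \<subseteq> incident edge UNIV u \<and> even (card I) \<longrightarrow>
       (\<Sum>i\<in>incident edge UNIV u. if i \<in> I then 1 - x $ i else x $ i) \<ge> 1)"
    by (rule ball_cong[OF refl])
  then show ?thesis by (simp only: tseitin_polytope_def mem_Collect_eq)
qed

lemma handshake: "(\<Sum>v\<in>V. card (incident edge D v)) = 2 * card D"
proof -
  have "(\<Sum>v\<in>V. card (incident edge D v)) = (\<Sum>v\<in>V. \<Sum>i\<in>D. if v \<in> edge i then 1 else 0)"
    unfolding incident_def card_eq_sum by (intro sum.cong refl sum.inter_filter) simp
  also have "\<dots> = (\<Sum>i\<in>D. \<Sum>v\<in>V. if v \<in> edge i then 1 else 0)"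
    by (rule sum.swap)
  also have "\<dots> = (\<Sum>i\<in>D. 2)"
  proof (rule sum.cong)
    fix i
    have "{v \<in> V. v \<in> edge i} = edge i" using edge_subset by blast
    then show "(\<Sum>v\<in>V. if v \<in> edge i then 1 else 0) = (2::nat)"
      using sum.inter_filter[OF finite_V, of "\<lambda>_. 1::nat" "\<lambda>v. v \<in> edge i"] card_edge[of i] by simp
  qed simp
  finally show ?thesis by simp
qed

text \<open>
  The inequality at \<open>u\<close> for the set of all incident edges of value 1 reads \<open>0 \<ge> 1\<close>, so in an integral
  point this set is odd at each of the odd number of vertices, against the handshake lemma.
\<close>

lemma integer_hull_empty: "integer_hull (tseitin_polytope V (range edge) edge) = {}"
proof -
  have False if x: "x \<in> tseitin_polytope V (range edge) edge" and int: "integral_vec x" for x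
  proof -
    have x01: "x $ i = 0 \<or> x $ i = 1" for i
    proof -
      obtain m where "x $ i = of_int m" using int by (auto simp: integral_vec_def elim: Ints_cases)
      moreover have "0 \<le> x $ i" "x $ i \<le> 1" using x by (auto simp: mem_tseitin_polytope)
      ultimately show ?thesis by (cases "m = 0") auto
    qed
    define D where "D = {i. x $ i = 1}"
    have "odd (card (incident edge D u))" if "u \<in> V" for u
    proof
      assume "even (card (incident edge D u))"
      moreover have "incident edge D u \<subseteq> incident edge UNIV u" by (auto simp: incident_def)
      ultimately have "(\<Sum>i\<in>incident edge UNIV u. if i \<in> incident edge D u then 1 - x $ i else x $ i) \<ge> 1"
        using x that unfolding mem_tseitin_polytope by blast
      moreover have "(\<Sum>i\<in>incident edge UNIV u. if i \<in> incident edge D u then 1 - x $ i else x $ i) = 0"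
        using x01 by (intro sum.neutral) (auto simp: incident_def D_def)
      ultimately show False by simp
    qed
    then have "{v \<in> V. odd (card (incident edge D v))} = V" by blast
    then have "even (\<Sum>v\<in>V. card (incident edge D v)) \<longleftrightarrow> even (card V)"
      using even_sum_iff[OF finite_V, of "\<lambda>v. card (incident edge D v)"] by simp
    then show False using handshake[of D] odd_V by simp
  qed
  then have "{x \<in> tseitin_polytope V (range edge) edge. integral_vec x} = {}"
    by blast
  then show ?thesis by (simp add: integer_hull_def)
qed

section \<open>Partial roundings\<close>

definition partial_rounding :: "'e set \<Rightarrow> 'v set \<Rightarrow> real ^ 'e \<Rightarrow> bool" where
  "partial_rounding R U x \<longleftrightarrow>
     (\<forall>i. if i \<in> induced U - R then x $ i = 1/2 else x $ i \<in> {0, 1}) \<and>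
     (\<forall>v\<in>V - U. odd (card (incident edge {i. x $ i = 1} v)))"

lemma partial_rounding_half:
  "partial_rounding R U x \<Longrightarrow> i \<in> induced U - R \<Longrightarrow> x $ i = 1/2"
  unfolding partial_rounding_def by presburger

lemma partial_rounding_integral:
  "partial_rounding R U x \<Longrightarrow> i \<notin> induced U - R \<Longrightarrow> x $ i = 0 \<or> x $ i = 1"
  unfolding partial_rounding_def by (metis insert_iff singletonD)

lemma partial_rounding_odd:
  "partial_rounding R U x \<Longrightarrow> v \<in> V \<Longrightarrow> v \<notin> U \<Longrightarrow>
    odd (card (incident edge {i. x $ i = 1} v))"
  by (simp add: partial_rounding_def)

lemma partial_rounding_half_integral:
  "partial_rounding R U x \<Longrightarrow> x $ i \<in> {0, 1/2, 1}"
  using partial_rounding_half partial_rounding_integral by (metis insert_iff)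

text \<open>
  At a core vertex the two half-valued edges alone contribute 1 to the sum, whatever \<open>I\<close> is. At any
  other vertex the summands are 0 or 1, and they all vanish only if \<open>I\<close> is the set of incident
  edges of value 1, which is odd.
\<close>

lemma partial_rounding_in_polytope:
  assumes x: "partial_rounding R U x" and U: "card U \<ge> 2"
    and conn: "edge_connected 2 edge (induced U - R) U"
  shows "x \<in> tseitin_polytope V (range edge) edge"
  unfolding mem_tseitin_polytope
proof (intro conjI ballI allI impI)
  have x3: "x $ i \<in> {0, 1/2, 1}" for i
    using partial_rounding_half_integral[OF x] .
  show "0 \<le> x $ i" "x $ i \<le> 1" for i using x3[of i] by auto
  fix u I assume u: "u \<in> V" and I: "I \<subseteq> incident edge UNIV u \<and> even (card I)"
  let ?f = "\<lambda>i. if i \<in> I then 1 - x $ i else x $ i"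
  have f0: "?f i \<ge> 0" for i using x3[of i] by auto
  show "(\<Sum>i\<in>incident edge UNIV u. ?f i) \<ge> 1"
  proof (cases "u \<in> U")
    case True
    then have "{u} \<subset> U" using U by (cases "U = {u}") auto
    then have "2 \<le> card (cut_edges edge (induced U - R) {u})"
      using conn by (auto simp: edge_connected_def)
    moreover have "(\<Sum>i\<in>cut_edges edge (induced U - R) {u}. ?f i) = (\<Sum>i\<in>cut_edges edge (induced U - R) {u}. 1/2)"
      by (intro sum.cong refl) (simp add: cut_edges_def partial_rounding_half[OF x])
    ultimately have "(\<Sum>i\<in>cut_edges edge (induced U - R) {u}. ?f i) \<ge> 1" by simp
    moreover have "(\<Sum>i\<in>cut_edges edge (induced U - R) {u}. ?f i) \<le> (\<Sum>i\<in>incident edge UNIV u. ?f i)"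
      using f0 by (intro sum_mono2) (auto simp: cut_edges_def incident_def)
    ultimately show ?thesis by linarith
  next
    case False
    have "\<exists>i\<in>incident edge UNIV u. ?f i \<noteq> 0"
    proof (rule ccontr)
      assume no: "\<not> ?thesis"
      have "I = incident edge {i. x $ i = 1} u"
      proof (intro equalityI subsetI)
        fix i assume "i \<in> I"
        then show "i \<in> incident edge {i. x $ i = 1} u"
          using no I by (auto simp: incident_def split: if_splits)
      next
        fix i assume "i \<in> incident edge {i. x $ i = 1} u"
        then show "i \<in> I" using no by (auto simp: incident_def split: if_splits)
      qed
      then show False using partial_rounding_odd[OF x u False] I by simp
    qed
    then obtain i where i: "i \<in> incident edge UNIV u" "?f i \<noteq> 0" by blast
    then have "i \<notin> induced U - R" using False by (auto simp: incident_def)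
    then have "x $ i = 0 \<or> x $ i = 1" by (rule partial_rounding_integral[OF x])
    then have "?f i = 1" using i by auto
    moreover have "?f i \<le> (\<Sum>i\<in>incident edge UNIV u. ?f i)"
      using f0 i by (intro member_le_sum) auto
    ultimately show ?thesis by linarith
  qed
qed

text \<open>
  Let \<open>F\<close> be the half-valued edges that leave the core. The labellings of \<open>F\<close> that make all vertices of
  \<open>W = U - U'\<close> odd form an affine space over the field with two elements. It is nonempty because every
  nonempty part of \<open>W\<close> has an edge of \<open>F\<close> in its cut. Since there are even two such edges, each
  \<open>i \<in> F\<close> lies in an edge set that is even at all of \<open>W\<close>; translating by that set matches the
  labellings with \<open>i\<close> on and off, so the uniform average takes the value \<open>1/2\<close> at \<open>i\<close>.
\<close>

lemma partial_rounding_average: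
  assumes x: "partial_rounding R U x" and U: "U \<subseteq> V"
    and conn: "edge_connected 2 edge (induced U - R) U"
    and U': "U' \<subseteq> U" "U' \<noteq> {}"
    and C: "convex C" "\<And>z. partial_rounding R U' z \<Longrightarrow> z \<in> C"
  shows "x \<in> C"
proof -
  define W where "W = U - U'"
  define F where "F = induced U - R - induced U'"
  define one where "one = {i. x $ i = 1}"
  have finW: "finite W" using U finite_V finite_subset unfolding W_def by blast
  have cutF: "2 \<le> card (cut_edges edge F T)" if T: "T \<subseteq> W" "T \<noteq> {}" for T
  proof -
    have "cut_edges edge F T = cut_edges edge (induced U - R) T"
      using T by (auto simp: cut_edges_def F_def W_def)
    moreover have "T \<subset> U" using T U' unfolding W_def by blast
    ultimately show ?thesis using conn T by (auto simp: edge_connected_def)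
  qed
  have cutF1: "cut_edges edge (F - {i}) T \<noteq> {}" if T: "T \<subseteq> W" "T \<noteq> {}" for T i
  proof
    assume "cut_edges edge (F - {i}) T = {}"
    then have "cut_edges edge F T \<subseteq> {i}" by (auto simp: cut_edges_def)
    then have "card (cut_edges edge F T) \<le> 1" using card_mono[of "{i}"] by fastforce
    then show False using cutF[OF T] by simp
  qed
  define Sols where "Sols = {D. D \<subseteq> F \<and> (\<forall>w\<in>W. odd (card (incident edge (one \<union> D) w)))}"
  have F_half: "x $ i = 1/2" if "i \<in> F" for i
    using that partial_rounding_half[OF x] by (simp add: F_def)
  have F_one: "F \<inter> one = {}"
  proof -
    have "i \<notin> one" if "i \<in> F" for i using F_half[OF that] by (simp add: one_def)
    then show ?thesis by blast
  qed
  have parity: "odd (card (incident edge (one \<union> D) w)) \<longleftrightarrow>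
      odd (card (incident edge one w)) \<noteq> odd (card (incident edge D w))" if "D \<subseteq> F" for D w
  proof -
    have "one \<union> D = sym_diff one D" using that F_one by auto
    then show ?thesis using odd_incident_sym_diff[of one D edge w] by simp
  qed
  \<comment> \<open>The edges of \<open>F\<close> have to toggle exactly the vertices that are even so far.\<close>
  have "\<exists>D\<subseteq>F. \<forall>w\<in>W. odd (card (incident edge D w)) \<longleftrightarrow>
      w \<in> {w. even (card (incident edge one w))}"
  proof (rule prescribed_parities)
    show "cut_edges edge F T \<noteq> {}" if "T \<subseteq> W" "T \<noteq> {}" for T
      using cutF[OF that] by force
  qed (simp_all add: finW card_edge)
  then obtain D where D: "D \<subseteq> F"
      "\<forall>w\<in>W. odd (card (incident edge D w)) \<longleftrightarrow> w \<in> {w. even (card (incident edge one w))}"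
    by blast
  then have "\<forall>w\<in>W. odd (card (incident edge (one \<union> D) w))"
    unfolding parity[OF D(1)] by blast
  then have ne: "Sols \<noteq> {}" using D(1) unfolding Sols_def by blast
  have fin: "finite Sols" by simp
  have half: "2 * card {D \<in> Sols. i \<in> D} = card Sols" if i: "i \<in> F" for i
  proof -
    \<comment> \<open>Avoiding \<open>i\<close>, realise the parities of the single edge \<open>i\<close>; adding \<open>i\<close> cancels them.\<close>
    have "\<exists>D\<subseteq>F - {i}. \<forall>w\<in>W. odd (card (incident edge D w)) \<longleftrightarrow> w \<in> edge i"
      by (rule prescribed_parities) (use finW card_edge cutF1 in simp_all)
    then obtain D where D: "D \<subseteq> F - {i}" "\<forall>w\<in>W. odd (card (incident edge D w)) \<longleftrightarrow> w \<in> edge i"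
      by blast
    let ?C = "sym_diff D {i}"
    have even: "even (card (incident edge ?C w))" if "w \<in> W" for w
    proof -
      have "odd (card (incident edge {i} w)) \<longleftrightarrow> w \<in> edge i"
      proof -
        have "incident edge {i} w = (if w \<in> edge i then {i} else {})" by (auto simp: incident_def)
        then show ?thesis by simp
      qed
      then show ?thesis using D(2) that odd_incident_sym_diff[of D "{i}" edge w] by simp
    qed
    have iC: "i \<in> ?C" "?C \<subseteq> F" using D(1) i by auto
    have closed: "sym_diff A ?C \<in> Sols" if A: "A \<in> Sols" for A
    proof -
      have AF: "A \<subseteq> F" and SF: "sym_diff A ?C \<subseteq> F" using A iC by (auto simp: Sols_def)
      have "odd (card (incident edge (one \<union> sym_diff A ?C) w))" if w: "w \<in> W" for w
      proof -
        have "odd (card (incident edge (one \<union> A) w))" using A w by (simp add: Sols_def)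
        then show ?thesis
          unfolding parity[OF SF] parity[OF AF] odd_incident_sym_diff[OF finite finite, of edge A ?C w]
          using even[OF w] by blast
      qed
      then show ?thesis using SF unfolding Sols_def by blast
    qed
    have "bij_betw (\<lambda>A. sym_diff A ?C) {D \<in> Sols. i \<in> D} {D \<in> Sols. i \<notin> D}"
    proof (rule bij_betw_byWitness[where f' = "\<lambda>A. sym_diff A ?C"])
      show "(\<lambda>A. sym_diff A ?C) ` {D \<in> Sols. i \<in> D} \<subseteq> {D \<in> Sols. i \<notin> D}"
        using closed iC(1) by blast
      show "(\<lambda>A. sym_diff A ?C) ` {D \<in> Sols. i \<notin> D} \<subseteq> {D \<in> Sols. i \<in> D}"
        using closed iC(1) by blast
    qed auto
    then have "card {D \<in> Sols. i \<in> D} = card {D \<in> Sols. i \<notin> D}" by (rule bij_betw_same_card)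
    moreover have "card Sols = card {D \<in> Sols. i \<in> D} + card {D \<in> Sols. i \<notin> D}"
      by (subst card_Un_disjoint[symmetric]) (auto intro: arg_cong[of _ _ card])
    ultimately show ?thesis by simp
  qed
  define z where "z D = (\<chi> i. if i \<in> F then (if i \<in> D then 1 else 0) else x $ i)" for D
  have z: "partial_rounding R U' (z D)" if D: "D \<in> Sols" for D
    unfolding partial_rounding_def
  proof (intro conjI allI ballI)
    fix i show "if i \<in> induced U' - R then z D $ i = 1/2 else z D $ i \<in> {0, 1}"
    proof (cases "i \<in> induced U - R")
      case True
      show ?thesis
      proof (cases "i \<in> induced U'")
        case outside: False
        then have "i \<in> F" using True by (simp add: F_def)
        then show ?thesis using outside by (simp add: z_def)
      next
        case inner: True
        then have "z D $ i = x $ i" by (simp add: z_def F_def)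
        then show ?thesis using inner True partial_rounding_half[OF x True] by simp
      qed
    next
      case False
      then have "i \<notin> F" "i \<notin> induced U' - R" using U'(1) by (auto simp: F_def)
      then show ?thesis using partial_rounding_integral[OF x False] by (auto simp: z_def)
    qed
  next
    fix v assume v: "v \<in> V - U'"
    have ones: "{i. z D $ i = 1} = one \<union> D"
      using D F_one by (auto simp: z_def one_def Sols_def)
    show "odd (card (incident edge {i. z D $ i = 1} v))"
    proof (cases "v \<in> U")
      case True
      then show ?thesis using D v unfolding ones by (auto simp: Sols_def W_def)
    next
      case False
      then have "incident edge D v = {}" using D by (auto simp: Sols_def F_def incident_def)
      then have "incident edge (one \<union> D) v = incident edge one v" by (auto simp: incident_def)
      then show ?thesis unfolding ones using partial_rounding_odd[OF x _ False] v by (simp add: one_def)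
    qed
  qed
  have "(\<Sum>D\<in>Sols. (1 / card Sols) *\<^sub>R z D) \<in> C"
    using fin ne C z by (intro convex_sum) auto
  also have "(\<Sum>D\<in>Sols. (1 / card Sols) *\<^sub>R z D) = x"
  proof -
    have pos: "real (card Sols) > 0" using fin ne by (simp add: card_gt_0_iff)
    have "(\<Sum>D\<in>Sols. (1 / card Sols) *\<^sub>R z D) $ i = x $ i" for i
    proof -
      have "(\<Sum>D\<in>Sols. (1 / card Sols) *\<^sub>R z D) $ i = (\<Sum>D\<in>Sols. z D $ i) / card Sols"
        by (simp add: sum_divide_distrib)
      also have "\<dots> = x $ i"
      proof (cases "i \<in> F")
        case True
        then have "(\<Sum>D\<in>Sols. z D $ i) = card {D \<in> Sols. i \<in> D}"
          using sum.inter_filter[OF fin, of "\<lambda>_. 1::real" "\<lambda>D. i \<in> D"] by (simp add: z_def)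
        moreover have "2 * real (card {D \<in> Sols. i \<in> D}) = card Sols"
          using half[OF True] by (metis of_nat_mult of_nat_numeral)
        moreover have "a / b = 1/2" if "2 * a = b" "b > 0" for a b :: real
          using that by auto
        ultimately show ?thesis using pos unfolding F_half[OF True] by metis
      next
        case False
        then show ?thesis using ne by (simp add: z_def)
      qed
      finally show ?thesis .
    qed
    then show ?thesis by (simp add: vec_eq_iff)
  qed
  finally show ?thesis .
qed

end

section \<open>Large 3-edge-connected cores\<close>

locale expander = incidence_graph V edge
  for V :: "'v set" and edge :: "'e::finite \<Rightarrow> 'v set" +
  fixes c :: real
  assumes expansion: "T \<subseteq> V \<Longrightarrow> 2 * card T \<le> card V \<Longrightarrow> c * card T \<le> card (cut_edges edge UNIV T)"
    and c_gt_2: "c > 2"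
begin

text \<open>
  The right-hand side counts twice the edges between different parts of the partition of \<open>V\<close> into
  \<open>V - U\<close>, \<open>T\<close> and \<open>U - T\<close>. The three cuts of the parts together count each such edge twice as well, and
  expansion bounds each of them from below.
\<close>

lemma three_part_count:
  assumes "U \<subseteq> V" "T \<subseteq> U"
    and "2 * card (V - U) \<le> card V" "2 * card T \<le> card V" "2 * card (U - T) \<le> card V"
  shows "c * card V \<le> 2 * (card (cut_edges edge UNIV U) + card (cut_edges edge (induced U) T))"
proof -
  let ?S = "V - U" and ?A = "U - T" and ?X = "cut_edges edge (induced U) T"
  let ?Y = "\<lambda>Z. {i \<in> cut_edges edge UNIV U. edge i \<inter> Z \<noteq> {}}"
  have S: "cut_edges edge UNIV ?S = cut_edges edge UNIV U"
    using edge_subset by (fastforce simp: cut_edges_def)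
  have T: "cut_edges edge UNIV T \<subseteq> ?Y T \<union> ?X"
    using assms(2) by (fastforce simp: cut_edges_def)
  have A: "cut_edges edge UNIV ?A \<subseteq> ?Y ?A \<union> ?X"
  proof
    fix i assume i: "i \<in> cut_edges edge UNIV ?A"
    obtain a b where "edge i = {a, b}" by (rule edge_pair)
    then show "i \<in> ?Y ?A \<union> ?X" using i assms(2) by (auto simp: cut_edges_def)
  qed
  have disj: "?Y T \<inter> ?Y ?A = {}"
  proof (rule ccontr)
    assume "\<not> ?thesis"
    then obtain i where i: "i \<in> ?Y T" "i \<in> ?Y ?A" by blast
    obtain a b where "edge i = {a, b}" by (rule edge_pair)
    then show False using i assms(2) by (auto simp: cut_edges_def)
  qed
  have "card (?Y T) + card (?Y ?A) = card (?Y T \<union> ?Y ?A)"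
    using disj by (simp add: card_Un_disjoint)
  also have "\<dots> \<le> card (cut_edges edge UNIV U)" by (intro card_mono) auto
  finally have Y: "card (?Y T) + card (?Y ?A) \<le> card (cut_edges edge UNIV U)" .
  have cT: "card (cut_edges edge UNIV T) \<le> card (?Y T) + card ?X"
    using card_mono[OF _ T] card_Un_le[of "?Y T" ?X] by simp
  have cA: "card (cut_edges edge UNIV ?A) \<le> card (?Y ?A) + card ?X"
    using card_mono[OF _ A] card_Un_le[of "?Y ?A" ?X] by simp
  have finU: "finite U" using assms(1) finite_V finite_subset by blast
  have "card V = card ?S + card U"
    by (rule card_eq_card_Diff_plus[OF finite_V assms(1)])
  moreover have "card U = card T + card ?A"
    using card_eq_card_Diff_plus[OF finU assms(2)] by simp
  ultimately have "real (card V) = card ?S + (card T + card ?A)" by simp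
  then have "c * card V = c * card ?S + c * card T + c * card ?A"
    by (simp add: algebra_simps)
  also have "\<dots> \<le> card (cut_edges edge UNIV ?S) + card (cut_edges edge UNIV T) + card (cut_edges edge UNIV ?A)"
    using expansion[of ?S] expansion[of T] expansion[of ?A] assms by fastforce
  also have "\<dots> \<le> real (2 * (card (cut_edges edge UNIV U) + card ?X))"
    unfolding S using cT cA Y by (intro of_nat_mono) simp
  finally show ?thesis by simp
qed

text \<open>
  The factor 2 is the number of edges outside \<open>R\<close> that a discarded set may still send to the rest:
  discarding a nonempty set across a cut of at most two such edges preserves the bound.
\<close>

definition large_core :: "'e set \<Rightarrow> 'v set \<Rightarrow> bool" where
  "large_core R U \<longleftrightarrow> U \<subseteq> V \<and> card V < 2 * card U \<and> card (cut_edges edge (- R) U) \<le> 2 * card (V - U)"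

text \<open>
  By minimality, neither side of a cut with at most two edges is large. As \<open>V - U'\<close> is not large
  either, \<open>three_part_count\<close> gives at least \<open>c n / 2\<close> edges between the three parts, of which at most
  \<open>2 |V - U'| + 2\<close> are outside \<open>R\<close>. Because \<open>2 |V - U'| < n\<close>, this forces
  \<open>|R| + 1 \<ge> (c - 2) n / 2\<close>; the slack of 1 in the hypothesis is available because a core is shrunk only
  when at least one round is still to come.
\<close>

lemma obtain_3_edge_connected_core:
  assumes "large_core R U" and R: "card R + 1 < (c - 2) / 2 * card V"
  obtains U' where "U' \<subseteq> U" "large_core R U'" "edge_connected 3 edge (induced U' - R) U'"
proof -
  obtain U' where U': "large_core R U'" "U' \<subseteq> U"
    and least: "\<And>Z. large_core R Z \<Longrightarrow> Z \<subseteq> U \<Longrightarrow> card U' \<le> card Z"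
    using assms(1) ex_has_least_nat[of "\<lambda>Z. large_core R Z \<and> Z \<subseteq> U" U card] by blast
  have U'V: "U' \<subseteq> V" and big: "card V < 2 * card U'"
    and few: "card (cut_edges edge (- R) U') \<le> 2 * card (V - U')"
    using U'(1) by (auto simp: large_core_def)
  have finU': "finite U'" using U'V finite_V finite_subset by blast
  have nV: "card V = card (V - U') + card U'"
    by (rule card_eq_card_Diff_plus[OF finite_V U'V])
  have "edge_connected 3 edge (induced U' - R) U'"
  proof (rule ccontr)
    assume "\<not> ?thesis"
    then obtain T where T: "T \<noteq> {}" "T \<subset> U'" and "\<not> 3 \<le> card (cut_edges edge (induced U' - R) T)"
      unfolding edge_connected_def by blast
    then have two: "card (cut_edges edge (induced U' - R) T) \<le> 2" by simp
    \<comment> \<open>A large side of the cut would be a smaller core, as at least one vertex is discarded for at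
      most two new boundary edges.\<close>
    have shrink: "2 * card Z \<le> card V"
      if Z: "Z \<subset> U'" and eq: "cut_edges edge (induced U' - R) Z = cut_edges edge (induced U' - R) T" for Z
    proof (rule ccontr)
      assume "\<not> ?thesis"
      then have bigZ: "card V < 2 * card Z" by simp
      have "cut_edges edge (- R) Z \<subseteq> cut_edges edge (- R) U' \<union> cut_edges edge (induced U' - R) Z"
        using Z by (fastforce simp: cut_edges_def)
      then have "card (cut_edges edge (- R) Z) \<le> card (cut_edges edge (- R) U') + card (cut_edges edge (induced U' - R) Z)"
        using card_mono[of "cut_edges edge (- R) U' \<union> cut_edges edge (induced U' - R) Z"]
          card_Un_le[of "cut_edges edge (- R) U'" "cut_edges edge (induced U' - R) Z"]
        by (meson finite le_trans)
      then have "card (cut_edges edge (- R) Z) \<le> 2 * (card (V - U') + 1)" using few two eq by simp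
      also have "\<dots> \<le> 2 * card (V - Z)"
      proof -
        have "V - U' \<subset> V - Z" using Z U'V by blast
        then have "card (V - U') < card (V - Z)" using finite_V by (simp add: psubset_card_mono)
        then show ?thesis by simp
      qed
      finally have "large_core R Z" using Z U'V bigZ by (auto simp: large_core_def)
      then have "card U' \<le> card Z" using least Z U'(2) by blast
      then show False using psubset_card_mono[OF finU' Z] by simp
    qed
    have compl: "cut_edges edge (induced U' - R) (U' - T) = cut_edges edge (induced U' - R) T"
      using T by (fastforce simp: cut_edges_def)
    have "2 * card T \<le> card V" using T(2) by (rule shrink) (rule refl)
    moreover have "2 * card (U' - T) \<le> card V" using T by (intro shrink compl) blast
    moreover have "2 * card (V - U') \<le> card V" using nV big by simp
    ultimately
    have "c * card V \<le> 2 * (card (cut_edges edge UNIV U') + card (cut_edges edge (induced U') T))"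
      using T(2) by (intro three_part_count U'V) auto
    also have "card (cut_edges edge UNIV U') + card (cut_edges edge (induced U') T) =
        card (cut_edges edge UNIV U' \<union> cut_edges edge (induced U') T)"
      by (rule card_Un_disjoint[symmetric]) (auto simp: cut_edges_def)
    also have "\<dots> \<le> card (cut_edges edge (- R) U' \<union> cut_edges edge (induced U' - R) T \<union> R)"
      by (intro card_mono) (auto simp: cut_edges_def)
    also have "\<dots> \<le> card (cut_edges edge (- R) U') + card (cut_edges edge (induced U' - R) T) + card R"
      by (meson add_mono card_Un_le le_refl le_trans)
    also have "\<dots> \<le> 2 * card (V - U') + 2 + card R" using few two by simp
    finally have "c * card V \<le> 4 * card (V - U') + 4 + 2 * card R" by simp
    moreover have "2 * card (V - U') + 1 \<le> card V" using nV big by simp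
    then have "2 * real (card (V - U')) + 1 \<le> card V" by linarith
    ultimately show False using R by (simp add: algebra_simps)
  qed
  then show thesis using that U' by blast
qed

section \<open>Survival of the half point\<close>

text \<open>
  The invariant is 2-edge-connectivity: it is what the polytope and the averaging argument need, and
  it is what is left of the 3-edge-connectivity of a minimal core after rounding one edge. Hence every
  round shrinks the core, averages, and rounds one edge, whose two values are covered by the
  induction hypothesis.
\<close>

lemma partial_rounding_in_iterated_closure:
  assumes "partial_rounding R U x" "large_core R U"
    and "edge_connected 2 edge (induced U - R) U"
    and "card R + k < (c - 2) / 2 * card V"
  shows "x \<in> (split_closure ^^ k) (tseitin_polytope V (range edge) edge)"
  using assms
proof (induction k arbitrary: R U x)
  case 0
  have "2 \<le> card U"
  proof (rule ccontr)
    assume "\<not> ?thesis"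
    then have "card V < 2" "U \<subseteq> V" using 0 by (auto simp: large_core_def)
    then have "card V = 1" using odd_V by (cases "card V") auto
    then obtain v where "V = {v}" by (auto simp: card_1_singleton_iff)
    moreover obtain a b where "a \<noteq> b" "a \<in> V" "b \<in> V" by (rule edge_pair)
    ultimately show False by auto
  qed
  then show ?case using partial_rounding_in_polytope 0 by simp
next
  case (Suc k)
  let ?P = "tseitin_polytope V (range edge) edge"
  obtain U' where U': "U' \<subseteq> U" "large_core R U'" and conn3: "edge_connected 3 edge (induced U' - R) U'"
    using obtain_3_edge_connected_core[OF Suc.prems(2)] Suc.prems(4) by auto
  have conn2: "edge_connected 2 edge (induced U' - R) U'"
    unfolding edge_connected_def
  proof (intro allI impI)
    fix T assume "T \<noteq> {} \<and> T \<subset> U'"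
    then have "3 \<le> card (cut_edges edge (induced U' - R) T)"
      using conn3 unfolding edge_connected_def by blast
    then show "2 \<le> card (cut_edges edge (induced U' - R) T)" by simp
  qed
  have "z \<in> split_closure ((split_closure ^^ k) ?P)" if z: "partial_rounding R U' z" for z
  proof (rule split_closure_half_integral)
    show "z \<in> (split_closure ^^ k) ?P"
      using Suc.IH[OF z U'(2) conn2] Suc.prems(4) by simp
    show "z $ i \<in> {0, 1/2, 1}" for i
      using partial_rounding_half_integral[OF z] .
    fix i and t :: real assume i: "z $ i = 1/2" and t: "t \<in> {0, 1}"
    have iU: "i \<in> induced U' - R"
    proof (rule ccontr)
      assume "i \<notin> induced U' - R"
      then show False using partial_rounding_integral[OF z] i by force
    qed
    let ?y = "\<chi> j. if j = i then t else z $ j" and ?R = "insert i R"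
    show "?y \<in> (split_closure ^^ k) ?P"
    proof (rule Suc.IH)
      show "partial_rounding ?R U' ?y"
        unfolding partial_rounding_def
      proof (intro conjI allI ballI)
        fix j show "if j \<in> induced U' - ?R then ?y $ j = 1/2 else ?y $ j \<in> {0, 1}"
          using t partial_rounding_half[OF z, of j] partial_rounding_integral[OF z, of j] by auto
      next
        fix v assume v: "v \<in> V - U'"
        then have "v \<notin> edge i" using iU by auto
        then have "incident edge {j. ?y $ j = 1} v = incident edge {j. z $ j = 1} v"
          by (auto simp: incident_def)
        then show "odd (card (incident edge {j. ?y $ j = 1} v))"
          using partial_rounding_odd[OF z] v by simp
      qed
      have "cut_edges edge (- ?R) U' \<subseteq> cut_edges edge (- R) U'" by (auto simp: cut_edges_def)
      then have "card (cut_edges edge (- ?R) U') \<le> card (cut_edges edge (- R) U')" by (simp add: card_mono)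
      then show "large_core ?R U'" using U'(2) by (simp add: large_core_def)
      show "edge_connected 2 edge (induced U' - ?R) U'"
        unfolding edge_connected_def
      proof (intro allI impI)
        fix T assume "T \<noteq> {} \<and> T \<subset> U'"
        then have "3 \<le> card (cut_edges edge (induced U' - R) T)"
          using conn3 unfolding edge_connected_def by blast
        moreover have "cut_edges edge (induced U' - ?R) T = cut_edges edge (induced U' - R) T - {i}"
          by (auto simp: cut_edges_def)
        ultimately show "2 \<le> card (cut_edges edge (induced U' - ?R) T)"
          using diff_card_le_card_Diff[of "{i}" "cut_edges edge (induced U' - R) T"] by simp
      qed
      show "real (card ?R + k) < (c - 2) / 2 * card V"
        using Suc.prems(4) iU by simp
    qed
  qed
  moreover have "U' \<noteq> {}" using U'(2) by (auto simp: large_core_def)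
  ultimately have "x \<in> split_closure ((split_closure ^^ k) ?P)"
    using Suc.prems(1-3) U'(1) convex_split_closure
    by (intro partial_rounding_average[of R U x U']) (auto simp: large_core_def)
  then show ?case by simp
qed

lemma iterated_closure_nonempty:
  assumes "k < (c - 2) / 2 * card V"
  shows "(split_closure ^^ k) (tseitin_polytope V (range edge) edge) \<noteq> {}"
proof -
  have V0: "0 < card V" using odd_V by (cases "card V") auto
  have "(\<chi> i. 1/2) \<in> (split_closure ^^ k) (tseitin_polytope V (range edge) edge)"
  proof (rule partial_rounding_in_iterated_closure)
    show "partial_rounding {} V (\<chi> i. 1/2)"
      using edge_subset by (simp add: partial_rounding_def)
    have "cut_edges edge UNIV V = {}" using edge_subset by (auto simp: cut_edges_def)
    then show "large_core {} V" using V0 by (simp add: large_core_def)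
    show "edge_connected 2 edge (induced V - {}) V"
      unfolding edge_connected_def
    proof (intro allI impI)
      have cut2: "2 \<le> card (cut_edges edge UNIV T)" if T: "T \<subseteq> V" "T \<noteq> {}" "2 * card T \<le> card V" for T
      proof -
        have "1 \<le> card T" using T finite_V finite_subset by (metis Suc_leI One_nat_def card_gt_0_iff)
        then have "2 * 1 \<le> c * card T" using c_gt_2 by (intro mult_mono) auto
        then show ?thesis using expansion[OF T(1,3)] by linarith
      qed
      fix T assume T: "T \<noteq> {} \<and> T \<subset> V"
      have "cut_edges edge UNIV (V - T) = cut_edges edge UNIV T"
        using edge_subset T by (fastforce simp: cut_edges_def)
      moreover have "card (V - T) + card T = card V"
        using card_eq_card_Diff_plus[OF finite_V, of T] T by auto
      then have "2 * card T \<le> card V \<or> 2 * card (V - T) \<le> card V" by linarith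
      ultimately have "2 \<le> card (cut_edges edge UNIV T)"
        using cut2[of T] cut2[of "V - T"] T by auto
      then show "2 \<le> card (cut_edges edge (induced V - {}) T)" using edge_subset by simp
    qed
    show "real (card ({}::'e set) + k) < (c - 2) / 2 * card V" using assms by simp
  qed
  then show ?thesis by blast
qed

lemma split_rank_ge:
  "ereal ((c - 2) / 2 * card V) \<le> ereal_of_enat (split_rank (tseitin_polytope V (range edge) edge))"
proof -
  let ?P = "tseitin_polytope V (range edge) edge"
  let ?K = "{k. (split_closure ^^ k) ?P = integer_hull ?P}"
  show ?thesis
  proof (cases "?K = {}")
    case True
    then have "split_rank ?P = \<infinity>" by (simp add: split_rank_def Inf_enat_def)
    then show ?thesis by simp
  next
    case False
    then have "split_rank ?P \<in> enat ` ?K"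
      unfolding split_rank_def by (metis (no_types, lifting) image_is_empty wellorder_InfI ex_in_conv)
    then obtain k where "split_rank ?P = enat k" "(split_closure ^^ k) ?P = {}"
      using integer_hull_empty by auto
    then show ?thesis using iterated_closure_nonempty[of k] by force
  qed
qed

end

lemma card_cut_eq_edges_between:
  assumes "inj edge" and "\<And>i. edge i \<subseteq> V" and "\<And>i. card (edge i) = 2"
  shows "card (cut_edges edge UNIV S) = edges_between (range edge) S (V - S)"
proof -
  have "edge ` cut_edges edge UNIV S = {e \<in> range edge. \<exists>u\<in>S. \<exists>v\<in>V - S. e = {u, v}}"
  proof (intro equalityI subsetI)
    fix e assume "e \<in> edge ` cut_edges edge UNIV S"
    then obtain i u v where i: "e = edge i" "u \<in> edge i" "v \<in> edge i" "u \<in> S" "v \<notin> S"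
      by (auto simp: cut_edges_def)
    obtain a b where "edge i = {a, b}" using assms(3)[of i] by (auto simp: card_2_iff)
    then have "edge i = {u, v}" using i by auto
    then show "e \<in> {e \<in> range edge. \<exists>u\<in>S. \<exists>v\<in>V - S. e = {u, v}}"
      using i assms(2)[of i] by auto
  qed (fastforce simp: cut_edges_def)
  then show ?thesis
    unfolding edges_between_def using card_image[of edge "cut_edges edge UNIV S"] assms(1)
    by (metis inj_on_subset subset_UNIV)
qed

theorem corollary1:
  fixes V :: "'v set" and E :: "'v set set" and edge :: "'e::finite \<Rightarrow> 'v set" and c :: real
  assumes "simple_graph V E"
    and "bij_betw edge UNIV E"
    and "odd (card V)"
    and "c = edge_expansion V E"
    and "c > 2"
  shows "ereal_of_enat (split_rank (tseitin_polytope V E edge)) \<ge> ereal ((c - 2) / 2 * real (card V))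
    \<and> (\<forall>d. regular_graph V E d \<longrightarrow>
          ereal_of_enat (split_rank (tseitin_polytope V E edge)) \<ge> ereal ((c - 2) / real d * real (card E)))"
proof -
  have E: "E = range edge" and inj: "inj edge" using assms(2) by (auto simp: bij_betw_def)
  have V: "finite V" and eV: "edge i \<subseteq> V" and e2: "card (edge i) = 2" for i
    using assms(1) by (auto simp: simple_graph_def E)
  interpret incidence_graph V edge
    by unfold_locales (use V eV e2 inj assms(3) in auto)
  interpret expander V edge c
  proof
    fix T assume T: "T \<subseteq> V" "2 * card T \<le> card V"
    show "c * card T \<le> card (cut_edges edge UNIV T)"
    proof (cases "T = {}")
      case False
      then have pos: "0 < card T" using T(1) V by (simp add: card_gt_0_iff finite_subset)
      let ?M = "{real (edges_between E S (V - S)) / real (card S) | S.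
            S \<subseteq> V \<and> S \<noteq> {} \<and> real (card S) \<le> real (card V) / 2}"
      have "?M \<subseteq> (\<lambda>S. real (edges_between E S (V - S)) / real (card S)) ` Pow V" by blast
      then have "finite ?M" using V finite_subset by blast
      moreover have "real (card T) \<le> real (card V) / 2" using T(2) by linarith
      then have "real (edges_between E T (V - T)) / real (card T) \<in> ?M" using T False by blast
      ultimately have "c \<le> real (edges_between E T (V - T)) / real (card T)"
        unfolding assms(4) edge_expansion_def by (rule Min_le)
      then show ?thesis
        using pos card_cut_eq_edges_between[OF inj eV e2, of T] by (simp add: E field_simps)
    qed simp
  qed (use assms(5) in auto)
  have main: "ereal ((c - 2) / 2 * card V) \<le> ereal_of_enat (split_rank (tseitin_polytope V E edge))"
    using split_rank_ge by (simp add: E)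
  moreover have "(c - 2) / real d * real (card E) \<le> (c - 2) / 2 * card V" if d: "regular_graph V E d" for d
  proof (cases "d = 0")
    case True
    then show ?thesis using assms(5) by simp
  next
    case False
    have "card (incident edge UNIV v) = d" if "v \<in> V" for v
      using bij_betw_same_card[OF bij_neighbours_incident[OF that]] d that
      by (simp add: regular_graph_def E)
    then have "card V * d = 2 * CARD('e)" using handshake[of UNIV] by simp
    moreover have "card E = CARD('e)" using inj by (simp add: E card_image)
    ultimately have card_E: "real (card E) = real (card V) * real d / 2"
      by (metis nonzero_mult_div_cancel_left of_nat_mult of_nat_numeral zero_neq_numeral)
    show ?thesis unfolding card_E using False by simp
  qed
  ultimately show ?thesis by (metis ereal_less_eq(3) order_trans)
qed

end
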